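(* The $\mathcal U$-Fourier transform $\mathcal F_{\mathcal U}$ is a bijective homeomorphism from $\mathcal C^\infty_{\mathcal U,\Lambda}$ to $\mathcal S(I)$. Its inverse $\mathcal F_{\mathcal U}^{-1}:\mathcal S(I)\to\mathcal C^\infty_{\mathcal U,\Lambda}$ is given by $$\mathcal F_{\mathcal U}^{-1}h=\sum_{\xi\in I}h(\xi)u_\xi,\qquad h\in\mathcal S(I),$$ so that the Fourier inversion formula becomes $$f=\sum_{\xi\in I}\widehat f(\xi)u_\xi\qquad\text{for all } f\in\mathcal C^\infty_{\mathcal U,\Lambda}.$$ Similarly, $\mathcal F_{\mathcal V}:\mathcal C^\infty_{\mathcal V,\Lambda}\to\mathcal S(I)$ is a bijective homeomorphism and its inverse $\mathcal F_{\mathcal V}^{-1}:\mathcal S(I)\to\mathcal C^\infty_{\mathcal V,\Lambda}$ is given by $$\mathcal F_{\mathcal V}^{-1}h=\sum_{\xi\in I}h(\xi)v_\xi,\qquad h\in\mathcal S(I),$$ so that the conjugate Fourier inversion formula becomes $$f=\sum_{\xi\in I}\widehat f_{\ast}(\xi)v_\xi\qquad\text{for all } f\in\mathcal C^\infty_{\mathcal V,\Lambda}.$$ By the duality formulas $\langle\mathcal F_{\mathcal U}(w),a\rangle=\langle w,\mathcal F_{\mathcal V}^{-1}(a)\rangle$ for $w\in\mathcal D'_{\mathcal U,\Lambda}$, $a\in\mathcal S(I)$, and $\langle\mathcal F_{\mathcal V}(w),a\rangle=\langle w,\mathcal F_{\mathcal U}^{-1}(a)\rangle$ for $w\in\mathcal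 D'_{\mathcal V,\Lambda}$, $a\in\mathcal S(I)$, the Fourier transforms extend to linear continuous mappings $\mathcal F_{\mathcal U}:\mathcal D'_{\mathcal U,\Lambda}\to\mathcal S'(I)$ and $\mathcal F_{\mathcal V}:\mathcal D'_{\mathcal V,\Lambda}\to\mathcal S'(I)$.
   Context: $\mathcal H$ is a separable complex Hilbert space with inner product $(\cdot,\cdot)$, linear in the first argument. $I$ is a discrete (countable) index set. $\mathcal U=\{u_\xi\}_{\xi\in I}$ is a Riesz basis of $\mathcal H$, and $\mathcal V=\{v_\xi\}_{\xi\in I}\subset\mathcal H$ is the system biorthogonal to $\mathcal U$: $(u_\xi,v_\eta)=\delta_{\xi\eta}$; then $\mathcal V$ is also a Riesz basis. $\Lambda=\{\lambda_\xi\}_{\xi\in I}$ is a fixed sequence of complex numbers such that $\sum_{\xi\in I}(1+|\lambda_\xi|)^{-s_0}<\infty$ for some $s_0>0$. For $f\in\mathcal H$: $\mathcal F_{\mathcal U}f(\xi)=\widehat f(\xi):=(f,v_\xi)$ and $\mathcal F_{\mathcal V}f(\xi)=\widehat f_{\ast}(\xi):=(f,u_\xi)$. Test functions: $\mathcal C^\infty_{\mathcal U,\Lambda}$ is the space of $\phi\in\mathcal H$ such that for every $k\in\{0,1,2,\dots\}$ there is $C$ with $|(\phi,v_\xi)|\le C(1+|\lambda_\xi|)^{-k}$ for all $\xi\in I$, topologized by the seminorms $\sup_{\xi}(1+|\lambda_\xi|)^k|(\phi,v_\xi)|$. $\mathcal C^\infty_{\mathcal V,\Lambda}$ is defined in the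 same way with $u_\xi$ in place of $v_\xi$. $\mathcal S(I)$ is the space of $\varphi:I\to\mathbb C$ such that for every $M<\infty$ there is $C_{\varphi,M}$ with $|\varphi(\xi)|\le C_{\varphi,M}(1+|\lambda_\xi|)^{-M}$ for all $\xi\in I$, topologized by the seminorms $p_k(\varphi)=\sup_\xi(1+|\lambda_\xi|)^k|\varphi(\xi)|$, $k=0,1,2,\dots$. $\mathcal S'(I)$ is the space of continuous antilinear functionals on $\mathcal S(I)$; these have the form $\varphi\mapsto\langle u,\varphi\rangle=\sum_{\xi\in I}u(\xi)\overline{\varphi(\xi)}$ with $u:I\to\mathbb C$ satisfying $|u(\xi)|\le C(1+|\lambda_\xi|)^M$ for some $M,C<\infty$. Distributions: $\mathcal D'_{\mathcal U,\Lambda}:=(\mathcal C^\infty_{\mathcal V,\Lambda})'$ and $\mathcal D'_{\mathcal V,\Lambda}:=(\mathcal C^\infty_{\mathcal U,\Lambda})'$ are the spaces of continuous antilinear functionals, with duality $\langle w,\phi\rangle$ extending the inner product: $\langle w,\phi\rangle=(w,\phi)$ when $w\in\mathcal H$. Dual spaces carry their weak-$*$ topologies. *)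

theory Defs
  imports "HOL-Analysis.Analysis" "HOL-Library.Function_Algebras"
begin

(* Complex Hilbert spaces: the inner product is linear in the first argument, and the norm and
   completeness are those of the underlying real Banach space. *)

class complex_hilbert_space = banach +
  fixes scaleC :: "complex \<Rightarrow> 'a \<Rightarrow> 'a"  (infixr "*\<^sub>C" 75)
    and cinner :: "'a \<Rightarrow> 'a \<Rightarrow> complex"
  assumes scaleC_add_right: "c *\<^sub>C (x + y) = c *\<^sub>C x + c *\<^sub>C y"
    and scaleC_add_left: "(c + d) *\<^sub>C x = c *\<^sub>C x + d *\<^sub>C x"
    and scaleC_scaleC: "c *\<^sub>C d *\<^sub>C x = (c * d) *\<^sub>C x"
    and scaleC_of_real: "complex_of_real r *\<^sub>C x = r *\<^sub>R x"
    and cinner_commute: "cinner x y = cnj (cinner y x)"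
    and cinner_add_left: "cinner (x + y) z = cinner x z + cinner y z"
    and cinner_scaleC_left: "cinner (c *\<^sub>C x) y = c * cinner x y"
    and cinner_same: "cinner x x = complex_of_real ((norm x)\<^sup>2)"

global_interpretation complex_vector:
  vector_space "scaleC :: complex \<Rightarrow> 'a \<Rightarrow> 'a::complex_hilbert_space"
  defines complex_span = complex_vector.span
proof
  fix x :: 'a
  show "1 *\<^sub>C x = x"
    using scaleC_of_real[of 1 x] by simp
qed (simp_all add: scaleC_add_right scaleC_add_left scaleC_scaleC)

definition orthonormal_basis :: "('i \<Rightarrow> 'h::complex_hilbert_space) \<Rightarrow> bool" where
  "orthonormal_basis e \<longleftrightarrow>
     (\<forall>\<xi> \<eta>. cinner (e \<xi>) (e \<eta>) = (if \<xi> = \<eta> then 1 else 0)) \<and>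
     closure (complex_span (range e)) = UNIV"

(* A Riesz basis is the image of an orthonormal basis under an invertible bounded operator. *)

definition riesz_basis :: "('i \<Rightarrow> 'h::complex_hilbert_space) \<Rightarrow> bool" where
  "riesz_basis u \<longleftrightarrow>
     (\<exists>(e :: 'i \<Rightarrow> 'h) (T :: 'h \<Rightarrow> 'h).
        orthonormal_basis e \<and>
        bounded_linear T \<and> (\<forall>c x. T (c *\<^sub>C x) = c *\<^sub>C T x) \<and>
        bij T \<and> bounded_linear (inv T) \<and>
        (\<forall>\<xi>. u \<xi> = T (e \<xi>)))"

definition biorthogonal ::
    "('i \<Rightarrow> 'h::complex_hilbert_space) \<Rightarrow> ('i \<Rightarrow> 'h) \<Rightarrow> bool" where
  "biorthogonal u v \<longleftrightarrow> (\<forall>\<xi> \<eta>. cinner (u \<xi>) (v \<eta>) = (if \<xi> = \<eta> then 1 else 0))"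

(* The transforms and the test function spaces are indexed by the system against which the
   coefficients are taken.  For a Riesz basis u with biorthogonal system v, the U-Fourier
   transform is fourier v and C^infinity_{U,Lambda} is test_functions l v, while the V-Fourier
   transform is fourier u and C^infinity_{V,Lambda} is test_functions l u. *)

definition fourier ::
    "('i \<Rightarrow> 'h::complex_hilbert_space) \<Rightarrow> 'h \<Rightarrow> 'i \<Rightarrow> complex" where
  "fourier w f = (\<lambda>\<xi>. cinner f (w \<xi>))"

definition test_functions ::
    "('i \<Rightarrow> complex) \<Rightarrow> ('i \<Rightarrow> 'h::complex_hilbert_space) \<Rightarrow> 'h set" where
  "test_functions l w =
     {\<phi>. \<forall>k::nat. \<exists>C::real. \<forall>\<xi>.
        cmod (cinner \<phi> (w \<xi>)) \<le> C * (1 + cmod (l \<xi>)) powr (- real k)}"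

definition rapidly_decreasing :: "('i \<Rightarrow> complex) \<Rightarrow> ('i \<Rightarrow> complex) set" where
  "rapidly_decreasing l =
     {\<phi>. \<forall>M::real. \<exists>C::real. \<forall>\<xi>. cmod (\<phi> \<xi>) \<le> C * (1 + cmod (l \<xi>)) powr (- M)}"

(* The topology on X induced by the seminorms p 0, p 1, ...: the balls form a subbasis. *)

definition seminorm_topology :: "'a set \<Rightarrow> (nat \<Rightarrow> 'a::minus \<Rightarrow> real) \<Rightarrow> 'a topology" where
  "seminorm_topology X p =
     topology_generated_by {{y \<in> X. p k (y - x) < \<epsilon>} | x k \<epsilon>. x \<in> X \<and> 0 < \<epsilon>}"

definition test_topology ::
    "('i \<Rightarrow> complex) \<Rightarrow> ('i \<Rightarrow> 'h::complex_hilbert_space) \<Rightarrow> 'h topology" where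
  "test_topology l w =
     seminorm_topology (test_functions l w)
       (\<lambda>k \<phi>. SUP \<xi>. (1 + cmod (l \<xi>)) ^ k * cmod (cinner \<phi> (w \<xi>)))"

definition rapid_topology :: "('i \<Rightarrow> complex) \<Rightarrow> ('i \<Rightarrow> complex) topology" where
  "rapid_topology l =
     seminorm_topology (rapidly_decreasing l)
       (\<lambda>k \<phi>. SUP \<xi>. (1 + cmod (l \<xi>)) ^ k * cmod (\<phi> \<xi>))"

(* Continuous antilinear functionals on a topological vector space with underlying set
   topspace X and scalar multiplication sc.  Functionals are extensional (undefined off the
   space), so that equality of functionals is equality on the space. *)

definition antidual ::
    "(complex \<Rightarrow> 'a \<Rightarrow> 'a) \<Rightarrow> 'a::plus topology \<Rightarrow> ('a \<Rightarrow> complex) set" where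
  "antidual sc X =
     {w \<in> extensional (topspace X).
        continuous_map X euclidean w \<and>
        (\<forall>x \<in> topspace X. \<forall>y \<in> topspace X. w (x + y) = w x + w y) \<and>
        (\<forall>c. \<forall>x \<in> topspace X. w (sc c x) = cnj c * w x)}"

definition weak_star_topology ::
    "(complex \<Rightarrow> 'a \<Rightarrow> 'a) \<Rightarrow> 'a::plus topology \<Rightarrow> ('a \<Rightarrow> complex) topology" where
  "weak_star_topology sc X =
     subtopology (product_topology (\<lambda>_. euclidean) (topspace X)) (antidual sc X)"

(* D'_{U,Lambda} is the dual of C^infinity_{V,Lambda}, hence distribution_topology l u, and
   D'_{V,Lambda} is the dual of C^infinity_{U,Lambda}, hence distribution_topology l v. *)

definition distribution_topology ::
    "('i \<Rightarrow> complex) \<Rightarrow> ('i \<Rightarrow> 'h::complex_hilbert_space) \<Rightarrow> ('h \<Rightarrow> complex) topology" where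
  "distribution_topology l w = weak_star_topology (*\<^sub>C) (test_topology l w)"

definition tempered_topology :: "('i \<Rightarrow> complex) \<Rightarrow> (('i \<Rightarrow> complex) \<Rightarrow> complex) topology" where
  "tempered_topology l = weak_star_topology (\<lambda>c \<phi> \<xi>. c * \<phi> \<xi>) (rapid_topology l)"

definition inner_functional ::
    "('i \<Rightarrow> complex) \<Rightarrow> ('i \<Rightarrow> 'h::complex_hilbert_space) \<Rightarrow> 'h \<Rightarrow> 'h \<Rightarrow> complex" where
  "inner_functional l w f = (\<lambda>\<phi> \<in> test_functions l w. cinner f \<phi>)"

(* The transform of distributions given by the duality formula <F(x), a> = <x, G(a)>, where G is
   the inverse of the transform fourier w on test_functions l w. *)

definition dual_fourier ::
    "('i \<Rightarrow> complex) \<Rightarrow> ('i \<Rightarrow> 'h::complex_hilbert_space) \<Rightarrow>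
      ('h \<Rightarrow> complex) \<Rightarrow> ('i \<Rightarrow> complex) \<Rightarrow> complex" where
  "dual_fourier l w x =
     (\<lambda>a \<in> rapidly_decreasing l. x (inv_into (test_functions l w) (fourier w) a))"

(* Linearity of a map F, defined on a set D of functionals on A, with values in the functionals
   on B; vector space operations on extensional functionals are pointwise on A resp. B. *)

definition linear_on_functionals ::
    "'a set \<Rightarrow> 'b set \<Rightarrow> ('a \<Rightarrow> complex) set \<Rightarrow> (('a \<Rightarrow> complex) \<Rightarrow> ('b \<Rightarrow> complex)) \<Rightarrow> bool" where
  "linear_on_functionals A B D F \<longleftrightarrow>
     (\<forall>x \<in> D. \<forall>y \<in> D. F (\<lambda>\<phi> \<in> A. x \<phi> + y \<phi>) = (\<lambda>a \<in> B. F x a + F y a)) \<and>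
     (\<forall>c. \<forall>x \<in> D. F (\<lambda>\<phi> \<in> A. c * x \<phi>) = (\<lambda>a \<in> B. c * F x a))"

end

theory Submission
  imports Defs
begin

text \<open>
  The coefficient map against \<open>v\<close> carries the seminorms defining the test functions to those of
  the rapidly decreasing sequences, so it is a homeomorphism as soon as it is a bijection.
  It is injective because \<open>v\<close> is total, and surjective because a rapidly decreasing \<open>h\<close> is
  absolutely summable, so that \<open>\<Sum>h(\<xi>)u\<^sub>\<xi>\<close> converges for bounded \<open>u\<close> and has coefficients \<open>h\<close> by
  biorthogonality. Only this boundedness and totality are needed of the two systems; for
  \<open>u\<^sub>\<xi> = T e\<^sub>\<xi>\<close> both follow from the identity \<open>(T x, v\<^sub>\<xi>) = (x, e\<^sub>\<xi>)\<close>, without using adjoints.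
\<close>

section \<open>Complex inner products\<close>

lemma cinner_add_right: "cinner x (y + z) = cinner x y + cinner x z"
  using cinner_commute[of x "y + z"] cinner_commute[of x y] cinner_commute[of x z]
  by (simp add: cinner_add_left)

lemma cinner_scaleC_right: "cinner x (c *\<^sub>C y) = cnj c * cinner x y"
  using cinner_commute[of x "c *\<^sub>C y"] cinner_commute[of x y] by (simp add: cinner_scaleC_left)

lemma cinner_scaleR_left: "cinner (r *\<^sub>R x) y = r *\<^sub>R cinner x y"
  using cinner_scaleC_left[of "complex_of_real r" x y]
  by (simp add: scaleC_of_real scaleR_conv_of_real)

lemma cinner_scaleR_right: "cinner x (r *\<^sub>R y) = r *\<^sub>R cinner x y"
  using cinner_scaleC_right[of x "complex_of_real r" y]
  by (simp add: scaleC_of_real scaleR_conv_of_real)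

lemma cinner_diff_left: "cinner (x - y) z = cinner x z - cinner y z"
  using cinner_add_left[of "x - y" y z] by simp

lemma cinner_diff_right: "cinner x (y - z) = cinner x y - cinner x z"
  using cinner_add_right[of x "y - z" z] by simp

lemma cinner_zero_left: "cinner 0 x = 0"
  using cinner_diff_left[of x x x] by simp

lemma cinner_zero_right: "cinner x 0 = 0"
  using cinner_diff_right[of x x x] by simp

text \<open>The norm comes from a real Banach space, so homogeneity under complex scalars has to be
  read off from (cx, cx) = |c|^2 (x, x).\<close>

lemma norm_scaleC: "norm (c *\<^sub>C x) = cmod c * norm x"
proof -
  have "complex_of_real ((norm (c *\<^sub>C x))\<^sup>2) = c * cnj c * complex_of_real ((norm x)\<^sup>2)"
    by (simp add: cinner_same[symmetric] cinner_scaleC_left cinner_scaleC_right del: of_real_power)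
  also have "\<dots> = complex_of_real ((cmod c * norm x)\<^sup>2)"
    by (simp add: complex_norm_square[symmetric] power_mult_distrib)
  finally have "(norm (c *\<^sub>C x))\<^sup>2 = (cmod c * norm x)\<^sup>2"
    using of_real_eq_iff by blast
  then show ?thesis by (simp add: power2_eq_iff_nonneg)
qed

lemma Cauchy_Schwarz_cinner: "cmod (cinner x y) \<le> norm x * norm y"
proof (cases "y = 0")
  case False
  \<comment> \<open>\<open>c *\<^sub>C y\<close> is the orthogonal projection of \<open>x\<close>
    onto the line through \<open>y\<close>; the inequality says that the squared norm of the
    remainder is nonnegative.\<close>
  define c where "c = cinner x y / complex_of_real ((norm y)\<^sup>2)"
  have c: "c * complex_of_real ((norm y)\<^sup>2) = cinner x y"
    using False by (simp add: c_def)
  have "cinner (x - c *\<^sub>C y) y = 0"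
    by (simp add: cinner_diff_left cinner_scaleC_left cinner_same c del: of_real_power)
  then have "cinner (x - c *\<^sub>C y) (x - c *\<^sub>C y) = cinner (x - c *\<^sub>C y) x"
    by (simp add: cinner_diff_right cinner_scaleC_right)
  also have "\<dots> = complex_of_real ((norm x)\<^sup>2) - c * cnj (cinner x y)"
    by (simp add: cinner_diff_left cinner_scaleC_left cinner_same cinner_commute[of y x]
        del: of_real_power)
  also have "\<dots> = complex_of_real ((norm x)\<^sup>2 - (cmod (cinner x y))\<^sup>2 / (norm y)\<^sup>2)"
    by (simp add: c_def complex_norm_square[symmetric] del: of_real_power)
  finally have "(norm (x - c *\<^sub>C y))\<^sup>2 = (norm x)\<^sup>2 - (cmod (cinner x y))\<^sup>2 / (norm y)\<^sup>2"
    unfolding cinner_same using of_real_eq_iff by blast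
  then have "(cmod (cinner x y))\<^sup>2 / (norm y)\<^sup>2 \<le> (norm x)\<^sup>2"
    by (metis diff_ge_0_iff_ge zero_le_power2)
  then have "(cmod (cinner x y))\<^sup>2 \<le> (norm x * norm y)\<^sup>2"
    using False by (simp add: divide_le_eq power_mult_distrib)
  then show ?thesis by (rule power2_le_imp_le) simp
qed (simp add: cinner_zero_right)

lemma bounded_linear_cinner_left: "bounded_linear (\<lambda>x. cinner x y)"
  by (rule bounded_linear_intro[where K = "norm y"])
     (simp_all add: cinner_add_left cinner_scaleR_left Cauchy_Schwarz_cinner)

lemma bounded_linear_cinner_right: "bounded_linear (\<lambda>y. cinner x y)"
proof (rule bounded_linear_intro[where K = "norm x"])
  show "cmod (cinner x y) \<le> norm y * norm x" for y
    using Cauchy_Schwarz_cinner[of x y] by (simp add: mult.commute)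
qed (simp_all add: cinner_add_right cinner_scaleR_right)

section \<open>Riesz bases\<close>

text \<open>The kernel of \<open>g\<close> is a closed complex subspace containing every
  \<open>e \<xi>\<close>, hence contains the closure of their span. Complex homogeneity is a
  separate assumption because \<open>bounded_linear\<close> speaks of real scalars only.\<close>

lemma eq_0_if_eq_0_on_orthonormal_basis:
  fixes g :: "'h::complex_hilbert_space \<Rightarrow> complex"
  assumes e: "orthonormal_basis e" and g: "bounded_linear g"
    and scale: "\<And>c x. g (c *\<^sub>C x) = c * g x" and zero: "\<And>\<xi>. g (e \<xi>) = 0"
  shows "g x = 0"
proof -
  interpret g: bounded_linear g by (rule g)
  have "complex_vector.subspace {x. g x = 0}"
    by (simp add: complex_vector.subspace_def g.zero g.add scale)
  then have "complex_span (range e) \<subseteq> {x. g x = 0}"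
    by (intro complex_vector.span_minimal) (auto simp: zero)
  moreover have "closed {x. g x = 0}"
    by (intro closed_Collect_eq continuous_intros g.continuous_on)
  ultimately have "closure (complex_span (range e)) \<subseteq> {x. g x = 0}"
    by (rule closure_minimal)
  then show ?thesis
    using e unfolding orthonormal_basis_def by auto
qed

text \<open>Collects all that is drawn from the Riesz property, for both systems at once, so that
  later arguments can be run with \<open>u\<close> and \<open>v\<close> in either order.\<close>

lemma riesz_basis_bounded_total:
  fixes u v :: "'i \<Rightarrow> 'h::complex_hilbert_space"
  assumes "riesz_basis u" and biorth: "biorthogonal u v"
  shows "bounded (range u)" "bounded (range v)"
    "(\<And>\<xi>. cinner f (u \<xi>) = 0) \<Longrightarrow> f = 0" "(\<And>\<xi>. cinner f (v \<xi>) = 0) \<Longrightarrow> f = 0"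
proof -
  obtain e :: "'i \<Rightarrow> 'h" and T :: "'h \<Rightarrow> 'h"
    where e: "orthonormal_basis e" and T: "bounded_linear T"
      and scale: "\<And>c x. T (c *\<^sub>C x) = c *\<^sub>C T x" and "bij T"
      and inv_T: "bounded_linear (inv T)" and u: "\<And>\<xi>. u \<xi> = T (e \<xi>)"
    using assms(1) unfolding riesz_basis_def by blast
  have T_inv: "T (inv T x) = x" for x
    using \<open>bij T\<close> by (simp add: bij_is_surj surj_f_inv_f)
  have on: "cinner (e \<xi>) (e \<eta>) = (if \<xi> = \<eta> then 1 else 0)" for \<xi> \<eta>
    using e by (simp add: orthonormal_basis_def)
  have norm_e: "norm (e \<xi>) = 1" for \<xi>
  proof -
    have "complex_of_real ((norm (e \<xi>))\<^sup>2) = complex_of_real 1"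
      using on[of \<xi> \<xi>] by (simp add: cinner_same)
    then have "(norm (e \<xi>))\<^sup>2 = 1" using of_real_eq_iff by blast
    then show ?thesis by (simp add: power2_eq_1_iff) (metis norm_ge_zero not_one_le_zero neg_0_le_iff_le)
  qed
  \<comment> \<open>In effect \<open>v \<xi>\<close> is the adjoint of \<open>inv T\<close> applied
    to \<open>e \<xi>\<close>. Both sides are bounded and linear in \<open>x\<close>, and at
    \<open>x = e \<eta>\<close> both are the Kronecker delta.\<close>
  have cinner_T_v: "cinner (T x) (v \<xi>) = cinner x (e \<xi>)" for x \<xi>
  proof -
    have "cinner (T x) (v \<xi>) - cinner x (e \<xi>) = 0"
    proof (rule eq_0_if_eq_0_on_orthonormal_basis[where x = "x"
          and g = "\<lambda>x. cinner (T x) (v \<xi>) - cinner x (e \<xi>)", OF e])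
      show "bounded_linear (\<lambda>x. cinner (T x) (v \<xi>) - cinner x (e \<xi>))"
        by (intro bounded_linear_sub bounded_linear_cinner_left
            bounded_linear_compose[OF bounded_linear_cinner_left T])
      show "cinner (T (e \<eta>)) (v \<xi>) - cinner (e \<eta>) (e \<xi>) = 0" for \<eta>
        using biorth by (simp add: on biorthogonal_def u)
    qed (simp add: scale cinner_scaleC_left right_diff_distrib)
    then show ?thesis by simp
  qed
  obtain K where K: "\<And>x. norm (T x) \<le> norm x * K"
    using bounded_linear.bounded[OF T] by blast
  show "bounded (range u)"
    using K[of "e _"] by (auto simp: bounded_iff u norm_e)
  obtain L where L: "\<And>x. norm (inv T x) \<le> norm x * L"
    using bounded_linear.bounded[OF inv_T] by blast
  \<comment> \<open>Writing one factor of (v, v) as T (inv T v) turns the squared norm into (inv T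
    v, e), which is at most L |v|. The sign of \<open>L\<close> is not known, so the maximum with 0
    covers the case \<open>v \<xi> = 0\<close>.\<close>
  have "norm (v \<xi>) \<le> max L 0" for \<xi>
  proof (cases "v \<xi> = 0")
    case False
    have "(norm (v \<xi>))\<^sup>2 = cmod (cinner (T (inv T (v \<xi>))) (v \<xi>))"
      by (simp add: T_inv cinner_same del: of_real_power)
    also have "\<dots> \<le> norm (inv T (v \<xi>)) * norm (e \<xi>)"
      unfolding cinner_T_v by (rule Cauchy_Schwarz_cinner)
    also have "\<dots> \<le> norm (v \<xi>) * L"
      using L by (simp add: norm_e)
    finally show ?thesis using False by (simp add: power2_eq_square)
  qed simp
  then show "bounded (range v)"
    by (auto simp: bounded_iff)
  show "f = 0" if zero: "\<And>\<xi>. cinner f (u \<xi>) = 0"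
  proof -
    \<comment> \<open>The map x -> (T x, f) vanishes on the orthonormal basis, and at
      \<open>inv T f\<close> its value is the squared norm of \<open>f\<close>.\<close>
    have "cinner (T (inv T f)) f = 0"
    proof (rule eq_0_if_eq_0_on_orthonormal_basis[where x = "inv T f"
          and g = "\<lambda>x. cinner (T x) f", OF e])
      show "bounded_linear (\<lambda>x. cinner (T x) f)"
        by (rule bounded_linear_compose[OF bounded_linear_cinner_left T])
      show "cinner (T (e \<xi>)) f = 0" for \<xi>
        using zero[of \<xi>] cinner_commute[of "T (e \<xi>)" f] by (simp add: u)
    qed (simp add: scale cinner_scaleC_left)
    then show ?thesis by (simp add: T_inv cinner_same)
  qed
  show "f = 0" if zero: "\<And>\<xi>. cinner f (v \<xi>) = 0"
  proof -
    \<comment> \<open>The coefficients of \<open>inv T f\<close> in the orthonormal basis are those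
      of \<open>f\<close> against \<open>v\<close>, so \<open>inv T f\<close> vanishes and with it
      \<open>f\<close>.\<close>
    have orth: "cinner (inv T f) (e \<xi>) = 0" for \<xi>
      using cinner_T_v[of "inv T f" \<xi>] zero by (simp add: T_inv)
    have "cinner (inv T f) (inv T f) = 0"
    proof (rule eq_0_if_eq_0_on_orthonormal_basis[where x = "inv T f"
          and g = "\<lambda>x. cinner x (inv T f)", OF e bounded_linear_cinner_left])
      show "cinner (e \<xi>) (inv T f) = 0" for \<xi>
        using orth[of \<xi>] cinner_commute[of "e \<xi>" "inv T f"] by simp
    qed (simp add: cinner_scaleC_left)
    then have "T (inv T f) = 0"
      using T by (simp add: cinner_same linear_simps)
    then show ?thesis by (simp add: T_inv)
  qed
qed

section \<open>Seminorm topologies\<close>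

lemma openin_seminorm_ball:
  "x \<in> X \<Longrightarrow> 0 < \<epsilon> \<Longrightarrow> openin (seminorm_topology X p) {y \<in> X. p k (y - x) < \<epsilon>}"
  unfolding seminorm_topology_def by (rule topology_generated_by_Basis) blast

text \<open>Since the seminorms vanish at 0, each point lies in the ball around itself, so the
  subbasic sets cover \<open>X\<close>.\<close>

lemma topspace_seminorm_topology:
  fixes X :: "'a::group_add set"
  assumes "\<And>k. p k 0 = 0"
  shows "topspace (seminorm_topology X p) = X"
proof
  show "topspace (seminorm_topology X p) \<subseteq> X"
    by (auto simp: seminorm_topology_def topology_generated_by_topspace)
  show "X \<subseteq> topspace (seminorm_topology X p)"
  proof
    fix x assume "x \<in> X"
    moreover from this have "x \<in> {y \<in> X. p 0 (y - x) < 1}" by (simp add: assms)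
    ultimately show "x \<in> topspace (seminorm_topology X p)"
      using openin_seminorm_ball[of x X 1 p 0] openin_subset by fastforce
  qed
qed

text \<open>By surjectivity a ball in \<open>Y\<close> has a centre \<open>F x'\<close>, and its
  preimage is the ball around \<open>x'\<close> with the same index and radius. Only seminorm
  distances are compared, so the argument applies equally to the inverse of
  \<open>F\<close>.\<close>

lemma continuous_map_seminorm_isometry:
  fixes p :: "nat \<Rightarrow> 'a::group_add \<Rightarrow> real" and q :: "nat \<Rightarrow> 'b::group_add \<Rightarrow> real"
  assumes bij: "bij_betw F X Y" and "\<And>k. p k 0 = 0" "\<And>k. q k 0 = 0"
    and isom: "\<And>k x y. x \<in> X \<Longrightarrow> y \<in> X \<Longrightarrow> q k (F y - F x) = p k (y - x)"
  shows "continuous_map (seminorm_topology X p) (seminorm_topology Y q) F"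
  unfolding seminorm_topology_def[of Y q]
proof (rule continuous_on_generated_topo)
  fix U assume "U \<in> {{y \<in> Y. q k (y - x) < \<epsilon>} |x k \<epsilon>. x \<in> Y \<and> 0 < \<epsilon>}"
  then obtain x k \<epsilon> where U: "U = {y \<in> Y. q k (y - x) < \<epsilon>}" and x: "x \<in> Y" "0 < \<epsilon>"
    by blast
  obtain x' where x': "x' \<in> X" "x = F x'"
    using x bij by (auto simp: bij_betw_def)
  have "F y \<in> U \<longleftrightarrow> p k (y - x') < \<epsilon>" if "y \<in> X" for y
    using isom[OF x'(1) that, of k] bij_betw_apply[OF bij that] x'(2) by (simp add: U)
  then have "F -` U \<inter> X = {y \<in> X. p k (y - x') < \<epsilon>}"
    by auto
  then show "openin (seminorm_topology X p) (F -` U \<inter> topspace (seminorm_topology X p))"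
    using x x' by (simp add: topspace_seminorm_topology assms openin_seminorm_ball)
next
  have "Y = \<Union> {{y \<in> Y. q k (y - x) < \<epsilon>} |x k \<epsilon>. x \<in> Y \<and> 0 < \<epsilon>}"
    using topspace_seminorm_topology[of q Y] assms(3)
    by (simp add: seminorm_topology_def topology_generated_by_topspace)
  then show "F ` topspace (seminorm_topology X p)
      \<subseteq> \<Union> {{y \<in> Y. q k (y - x) < \<epsilon>} |x k \<epsilon>. x \<in> Y \<and> 0 < \<epsilon>}"
    using bij by (simp add: topspace_seminorm_topology assms(2) bij_betw_def)
qed

lemma homeomorphic_maps_seminorm_isometry:
  fixes p :: "nat \<Rightarrow> 'a::group_add \<Rightarrow> real" and q :: "nat \<Rightarrow> 'b::group_add \<Rightarrow> real"
  assumes bij: "bij_betw F X Y" and p: "\<And>k. p k 0 = 0" and q: "\<And>k. q k 0 = 0"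
    and isom: "\<And>k x y. x \<in> X \<Longrightarrow> y \<in> X \<Longrightarrow> q k (F y - F x) = p k (y - x)"
  shows "homeomorphic_maps (seminorm_topology X p) (seminorm_topology Y q) F (inv_into X F)"
  unfolding homeomorphic_maps_def
proof (intro conjI)
  show "continuous_map (seminorm_topology X p) (seminorm_topology Y q) F"
    by (rule continuous_map_seminorm_isometry[OF bij p q isom])
  show "continuous_map (seminorm_topology Y q) (seminorm_topology X p) (inv_into X F)"
  proof (rule continuous_map_seminorm_isometry[where p = q and q = p, OF bij_betw_inv_into[OF bij] q p])
    fix k x y assume "x \<in> Y" "y \<in> Y"
    then show "p k (inv_into X F y - inv_into X F x) = q k (y - x)"
      using isom[of "inv_into X F x" "inv_into X F y" k] bij
      by (simp add: bij_betw_def inv_into_into f_inv_into_f)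
  qed
qed (use bij in \<open>auto simp: topspace_seminorm_topology p q bij_betw_def f_inv_into_f\<close>)

text \<open>One seminorm that controls the increments of \<open>g\<close> suffices: around each
  point a ball of that seminorm is mapped into any prescribed norm ball.\<close>

lemma continuous_map_seminorm_bounded:
  fixes p :: "nat \<Rightarrow> 'a::group_add \<Rightarrow> real" and g :: "'a \<Rightarrow> 'b::real_normed_vector"
  assumes p: "\<And>k. p k 0 = 0"
    and bound: "\<And>x y. x \<in> X \<Longrightarrow> y \<in> X \<Longrightarrow> norm (g y - g x) \<le> C * p k (y - x)"
    and nonneg: "\<And>x y. x \<in> X \<Longrightarrow> y \<in> X \<Longrightarrow> 0 \<le> p k (y - x)"
  shows "continuous_map (seminorm_topology X p) euclidean g"
  unfolding continuous_map_def
proof (intro conjI allI impI)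
  fix U :: "'b set" assume "openin euclidean U"
  then have "open U" by simp
  have "\<exists>T. openin (seminorm_topology X p) T \<and> x \<in> T \<and> T \<subseteq> {y \<in> X. g y \<in> U}"
    if x: "x \<in> X" "g x \<in> U" for x
  proof -
    obtain \<epsilon> where \<epsilon>: "\<epsilon> > 0" "ball (g x) \<epsilon> \<subseteq> U"
      using \<open>open U\<close> x(2) openE by blast
    \<comment> \<open>\<open>\<bar>C\<bar> + 1\<close> is positive and at least \<open>C\<close>,
      whatever the sign of \<open>C\<close>.\<close>
    define \<delta> where "\<delta> = \<epsilon> / (\<bar>C\<bar> + 1)"
    have \<delta>: "\<delta> > 0" using \<epsilon> by (simp add: \<delta>_def)
    have "g y \<in> U" if y: "y \<in> X" "p k (y - x) < \<delta>" for y
    proof -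
      have "norm (g y - g x) \<le> C * p k (y - x)"
        by (rule bound) (fact x y)+
      also have "\<dots> \<le> (\<bar>C\<bar> + 1) * p k (y - x)"
        using nonneg[OF x(1) y(1)] by (intro mult_right_mono) auto
      also have "\<dots> < (\<bar>C\<bar> + 1) * \<delta>"
        using y(2) by (intro mult_strict_left_mono) auto
      also have "\<dots> = \<epsilon>" by (simp add: \<delta>_def)
      finally show ?thesis using \<epsilon>(2) by (auto simp: dist_norm norm_minus_commute)
    qed
    then show ?thesis
      using openin_seminorm_ball[OF x(1) \<delta>, of p k] x(1) \<delta> p
      by (intro exI[of _ "{y \<in> X. p k (y - x) < \<delta>}"]) auto
  qed
  then have "openin (seminorm_topology X p) {y \<in> X. g y \<in> U}"
    by (subst openin_subopen) auto
  then show "openin (seminorm_topology X p) {y \<in> topspace (seminorm_topology X p). g y \<in> U}"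
    by (simp add: topspace_seminorm_topology p)
qed auto

section \<open>Rapidly decreasing sequences and test functions\<close>

lemma fourier_add: "fourier w (f + g) = fourier w f + fourier w g"
  by (simp add: fourier_def fun_eq_iff cinner_add_left)

lemma fourier_diff: "fourier w (f - g) = fourier w f - fourier w g"
  by (simp add: fourier_def fun_eq_iff cinner_diff_left)

lemma fourier_scaleC: "fourier w (c *\<^sub>C f) = (\<lambda>\<xi>. c * fourier w f \<xi>)"
  by (simp add: fourier_def fun_eq_iff cinner_scaleC_left)

text \<open>Test functions are defined by natural exponents, rapid decrease by real ones. The two
  agree because the base \<open>1 + cmod (l \<xi>)\<close> is at least 1, so a real exponent may be
  rounded up.\<close>

lemma rapidly_decreasing_iff_nat:
  "\<phi> \<in> rapidly_decreasing l \<longleftrightarrow>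
     (\<forall>k::nat. \<exists>C. \<forall>\<xi>. cmod (\<phi> \<xi>) \<le> C * (1 + cmod (l \<xi>)) powr (- real k))"
proof
  assume nat: "\<forall>k::nat. \<exists>C. \<forall>\<xi>. cmod (\<phi> \<xi>) \<le> C * (1 + cmod (l \<xi>)) powr (- real k)"
  have "\<exists>C. \<forall>\<xi>. cmod (\<phi> \<xi>) \<le> C * (1 + cmod (l \<xi>)) powr (- M)" for M
  proof -
    obtain k :: nat where k: "M \<le> real k" using real_arch_simple by blast
    obtain C where C: "\<And>\<xi>. cmod (\<phi> \<xi>) \<le> C * (1 + cmod (l \<xi>)) powr (- real k)"
      using nat by blast
    have "cmod (\<phi> \<xi>) \<le> \<bar>C\<bar> * (1 + cmod (l \<xi>)) powr (- M)" for \<xi>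
    proof -
      have "C * (1 + cmod (l \<xi>)) powr (- real k) \<le> \<bar>C\<bar> * (1 + cmod (l \<xi>)) powr (- M)"
        using k by (intro mult_mono powr_mono) auto
      with C[of \<xi>] show ?thesis by linarith
    qed
    then show ?thesis by blast
  qed
  then show "\<phi> \<in> rapidly_decreasing l" by (simp add: rapidly_decreasing_def)
qed (simp add: rapidly_decreasing_def)

text \<open>Reduces membership among test functions to a property of coefficient sequences, from
  which the closure under linear operations is inherited.\<close>

lemma mem_test_functions_iff: "f \<in> test_functions l w \<longleftrightarrow> fourier w f \<in> rapidly_decreasing l"
  by (simp add: test_functions_def rapidly_decreasing_iff_nat fourier_def)

lemma rapidly_decreasing_add:
  assumes "a \<in> rapidly_decreasing l" "b \<in> rapidly_decreasing l"
  shows "a + b \<in> rapidly_decreasing l"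
proof -
  have "\<exists>C. \<forall>\<xi>. cmod (a \<xi> + b \<xi>) \<le> C * (1 + cmod (l \<xi>)) powr (- M)" for M
  proof -
    obtain C D where "\<And>\<xi>. cmod (a \<xi>) \<le> C * (1 + cmod (l \<xi>)) powr (- M)"
      "\<And>\<xi>. cmod (b \<xi>) \<le> D * (1 + cmod (l \<xi>)) powr (- M)"
      using assms unfolding rapidly_decreasing_def by blast
    then have "cmod (a \<xi> + b \<xi>) \<le> (C + D) * (1 + cmod (l \<xi>)) powr (- M)" for \<xi>
      unfolding distrib_right by (intro norm_triangle_mono)
    then show ?thesis by blast
  qed
  then show ?thesis by (simp add: rapidly_decreasing_def)
qed

lemma rapidly_decreasing_scale:
  assumes "a \<in> rapidly_decreasing l"
  shows "(\<lambda>\<xi>. c * a \<xi>) \<in> rapidly_decreasing l"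
proof -
  have "\<exists>C. \<forall>\<xi>. cmod (c * a \<xi>) \<le> C * (1 + cmod (l \<xi>)) powr (- M)" for M
  proof -
    obtain C where C: "\<And>\<xi>. cmod (a \<xi>) \<le> C * (1 + cmod (l \<xi>)) powr (- M)"
      using assms unfolding rapidly_decreasing_def by blast
    have "cmod (c * a \<xi>) \<le> (cmod c * C) * (1 + cmod (l \<xi>)) powr (- M)" for \<xi>
      using mult_left_mono[OF C[of \<xi>], of "cmod c"] by (simp add: norm_mult mult.assoc)
    then show ?thesis by blast
  qed
  then show ?thesis by (simp add: rapidly_decreasing_def)
qed

lemma rapidly_decreasing_diff:
  assumes "a \<in> rapidly_decreasing l" "b \<in> rapidly_decreasing l"
  shows "a - b \<in> rapidly_decreasing l"
proof -
  have "a - b = a + (\<lambda>\<xi>. (- 1) * b \<xi>)" by (simp add: fun_eq_iff)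
  then show ?thesis
    using assms by (metis rapidly_decreasing_add rapidly_decreasing_scale)
qed

text \<open>With a name for this seminorm, the seminorms on test functions become its pullbacks
  under \<open>fourier w\<close>.\<close>

definition rapid_seminorm :: "('i \<Rightarrow> complex) \<Rightarrow> nat \<Rightarrow> ('i \<Rightarrow> complex) \<Rightarrow> real" where
  "rapid_seminorm l k \<phi> = (SUP \<xi>. (1 + cmod (l \<xi>)) ^ k * cmod (\<phi> \<xi>))"

lemma rapid_topology_eq:
  "rapid_topology l = seminorm_topology (rapidly_decreasing l) (rapid_seminorm l)"
  by (simp add: rapid_topology_def rapid_seminorm_def[abs_def])

lemma test_topology_eq:
  "test_topology l w =
     seminorm_topology (test_functions l w) (\<lambda>k f. rapid_seminorm l k (fourier w f))"
  by (simp add: test_topology_def rapid_seminorm_def fourier_def)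

lemma rapid_seminorm_zero: "rapid_seminorm l k 0 = 0"
  by (simp add: rapid_seminorm_def)

lemma fourier_zero: "fourier w 0 = 0"
  by (simp add: fourier_def fun_eq_iff cinner_zero_left)

lemma topspace_rapid_topology: "topspace (rapid_topology l) = rapidly_decreasing l"
  by (simp add: rapid_topology_eq topspace_seminorm_topology rapid_seminorm_zero)

lemma topspace_test_topology: "topspace (test_topology l w) = test_functions l w"
  by (simp add: test_topology_eq topspace_seminorm_topology rapid_seminorm_zero fourier_zero)

text \<open>Rapid decrease with exponent \<open>k\<close> bounds the weighted values, so that the
  supremum really is an upper bound.\<close>

lemma le_rapid_seminorm:
  assumes "\<phi> \<in> rapidly_decreasing l"
  shows "(1 + cmod (l \<xi>)) ^ k * cmod (\<phi> \<xi>) \<le> rapid_seminorm l k \<phi>"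
  unfolding rapid_seminorm_def
proof (rule cSUP_upper)
  obtain C where C: "\<And>\<xi>. cmod (\<phi> \<xi>) \<le> C * (1 + cmod (l \<xi>)) powr (- real k)"
    using assms unfolding rapidly_decreasing_def by blast
  have "(1 + cmod (l \<xi>)) ^ k * cmod (\<phi> \<xi>) \<le> C" for \<xi>
  proof -
    have pos: "1 + cmod (l \<xi>) > 0" by (simp add: add_pos_nonneg)
    have "cmod (\<phi> \<xi>) \<le> C / (1 + cmod (l \<xi>)) ^ k"
      using C[of \<xi>] pos by (simp add: powr_minus powr_realpow divide_inverse)
    then show ?thesis using pos by (simp add: pos_le_divide_eq mult.commute)
  qed
  then show "bdd_above (range (\<lambda>\<xi>. (1 + cmod (l \<xi>)) ^ k * cmod (\<phi> \<xi>)))"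
    by (rule bdd_aboveI2)
qed simp

lemma rapid_seminorm_nonneg:
  assumes "\<phi> \<in> rapidly_decreasing l"
  shows "0 \<le> rapid_seminorm l k \<phi>"
  \<comment> \<open>A single index gives the lower bound; \<open>undefined\<close> is one, as types
    are inhabited.\<close>
  by (rule order_trans[OF _ le_rapid_seminorm[OF assms, of undefined]]) simp

section \<open>The Fourier transform of a biorthogonal pair\<close>

text \<open>One half of the symmetric situation: expansions run in \<open>u\<close>, coefficients
  are taken against \<open>v\<close>. Interpreting it for both orders of the pair gives both
  transforms.\<close>

locale biorthogonal_system =
  fixes u v :: "'i \<Rightarrow> 'h::complex_hilbert_space" and l :: "'i \<Rightarrow> complex" and s :: real
  assumes biorth: "biorthogonal u v"
    and bounded_u: "bounded (range u)"
    and total_v: "\<And>f. (\<And>\<xi>. cinner f (v \<xi>) = 0) \<Longrightarrow> f = 0"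
    and summable: "(\<lambda>\<xi>. (1 + cmod (l \<xi>)) powr (- s)) summable_on UNIV"
begin

abbreviation inverse_fourier :: "('i \<Rightarrow> complex) \<Rightarrow> 'h" where
  "inverse_fourier \<equiv> inv_into (test_functions l v) (fourier v)"

section \<open>Expansions in \<open>u\<close> and the inversion formula\<close>

lemma fourier_inject: "fourier v f = fourier v g \<Longrightarrow> f = g"
  using total_v[of "f - g"] by (simp add: fourier_def fun_eq_iff cinner_diff_left)

text \<open>The term at \<open>\<xi>\<close> is at most a multiple of the \<open>k\<close>-th
  seminorm of \<open>h\<close> times a summable weight. As \<open>k\<close> and \<open>C\<close> do
  not depend on \<open>h\<close>, this yields convergence and also continuity of the expansion map
  into the Hilbert space.\<close>

lemma norm_expansion_bound:
  obtains k :: nat and C where "0 \<le> C"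
    "\<And>h. h \<in> rapidly_decreasing l \<Longrightarrow>
       (\<lambda>\<xi>. h \<xi> *\<^sub>C u \<xi>) summable_on UNIV \<and>
       norm (\<Sum>\<^sub>\<infinity>\<xi>. h \<xi> *\<^sub>C u \<xi>) \<le> C * rapid_seminorm l k h"
proof -
  obtain B where B: "B > 0" "\<And>\<xi>. norm (u \<xi>) \<le> B"
    using bounded_u by (auto simp: bounded_pos)
  \<comment> \<open>The base of the weight is at least 1, so decay of order \<open>k\<close> beats
    the summable weight of order \<open>s\<close>.\<close>
  obtain k :: nat where k: "s \<le> real k" using real_arch_simple by blast
  let ?w = "\<lambda>\<xi>. (1 + cmod (l \<xi>)) powr (- s)"
  show thesis
  proof (rule that[of "B * (\<Sum>\<^sub>\<infinity>\<xi>. ?w \<xi>)" k])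
    show "0 \<le> B * (\<Sum>\<^sub>\<infinity>\<xi>. ?w \<xi>)"
      using B(1) by (simp add: infsum_nonneg)
    fix h assume h: "h \<in> rapidly_decreasing l"
    let ?p = "rapid_seminorm l k h"
    have le: "norm (h \<xi> *\<^sub>C u \<xi>) \<le> (?p * B) * ?w \<xi>" for \<xi>
    proof -
      have pos: "1 + cmod (l \<xi>) > 0" by (simp add: add_pos_nonneg)
      have "cmod (h \<xi>) \<le> ?p * (1 + cmod (l \<xi>)) powr (- real k)"
        using le_rapid_seminorm[OF h, of \<xi> k] pos
        by (simp add: powr_minus powr_realpow field_simps)
      also have "\<dots> \<le> ?p * ?w \<xi>"
        using k by (intro mult_left_mono powr_mono rapid_seminorm_nonneg[OF h]) auto
      finally have "cmod (h \<xi>) * norm (u \<xi>) \<le> (?p * ?w \<xi>) * B"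
        using B by (intro mult_mono) (auto intro: mult_nonneg_nonneg rapid_seminorm_nonneg[OF h])
      then show ?thesis by (simp add: norm_scaleC mult_ac)
    qed
    have w: "(\<lambda>\<xi>. (?p * B) * ?w \<xi>) summable_on UNIV"
      using summable by (rule summable_on_cmult_right)
    have abs: "(\<lambda>\<xi>. norm (h \<xi> *\<^sub>C u \<xi>)) summable_on UNIV"
      by (rule summable_on_comparison_test[OF w]) (use le in auto)
    have "norm (\<Sum>\<^sub>\<infinity>\<xi>. h \<xi> *\<^sub>C u \<xi>) \<le> (\<Sum>\<^sub>\<infinity>\<xi>. norm (h \<xi> *\<^sub>C u \<xi>))"
      by (rule norm_infsum_bound) (rule abs)
    also have "\<dots> \<le> (\<Sum>\<^sub>\<infinity>\<xi>. (?p * B) * ?w \<xi>)"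
      by (rule infsum_mono[OF abs w]) (rule le)
    also have "\<dots> = B * (\<Sum>\<^sub>\<infinity>\<xi>. ?w \<xi>) * ?p"
      by (subst infsum_cmult_right) (use summable in auto)
    finally show "(\<lambda>\<xi>. h \<xi> *\<^sub>C u \<xi>) summable_on UNIV \<and>
        norm (\<Sum>\<^sub>\<infinity>\<xi>. h \<xi> *\<^sub>C u \<xi>) \<le> B * (\<Sum>\<^sub>\<infinity>\<xi>. ?w \<xi>) * ?p"
      using abs_summable_summable[OF abs] by blast
  qed
qed

text \<open>The bounded functional \<open>cinner _ (v \<eta>)\<close> passes through the sum, where
  biorthogonality leaves only the term at \<open>\<eta>\<close>.\<close>

lemma fourier_expansion:
  assumes "((\<lambda>\<xi>. h \<xi> *\<^sub>C u \<xi>) has_sum f) UNIV"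
  shows "fourier v f = h"
proof
  fix \<eta>
  have "((\<lambda>\<xi>. cinner (h \<xi> *\<^sub>C u \<xi>) (v \<eta>)) has_sum cinner f (v \<eta>)) UNIV"
    by (rule has_sum_bounded_linear[OF bounded_linear_cinner_left assms])
  moreover have "cinner (h \<xi> *\<^sub>C u \<xi>) (v \<eta>) = (if \<xi> = \<eta> then h \<eta> else 0)" for \<xi>
    using biorth by (simp add: cinner_scaleC_left biorthogonal_def)
  ultimately have "((\<lambda>\<xi>. if \<xi> = \<eta> then h \<eta> else 0) has_sum cinner f (v \<eta>)) UNIV"
    by simp
  moreover have "((\<lambda>\<xi>. if \<xi> = \<eta> then h \<eta> else 0) has_sum h \<eta>) UNIV"
    by (rule has_sum_finite_neutralI[of "{\<eta>}"]) auto
  ultimately show "fourier v f \<eta> = h \<eta>"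
    unfolding fourier_def by (rule has_sum_unique)
qed

lemma expansion_has_sum:
  assumes "h \<in> rapidly_decreasing l"
  shows "((\<lambda>\<xi>. h \<xi> *\<^sub>C u \<xi>) has_sum (\<Sum>\<^sub>\<infinity>\<xi>. h \<xi> *\<^sub>C u \<xi>)) UNIV"
  using assms norm_expansion_bound has_sum_infsum by metis

lemma bij_betw_fourier: "bij_betw (fourier v) (test_functions l v) (rapidly_decreasing l)"
  unfolding bij_betw_def
proof
  show "inj_on (fourier v) (test_functions l v)"
    by (rule inj_onI) (rule fourier_inject)
  have "h \<in> fourier v ` test_functions l v" if "h \<in> rapidly_decreasing l" for h
    using fourier_expansion[OF expansion_has_sum[OF that]] that
    by (metis imageI mem_test_functions_iff)
  then show "fourier v ` test_functions l v = rapidly_decreasing l"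
    by (auto simp: mem_test_functions_iff)
qed

lemma inverse_fourier_in: "h \<in> rapidly_decreasing l \<Longrightarrow> inverse_fourier h \<in> test_functions l v"
  using bij_betw_fourier by (metis bij_betw_def inv_into_into)

lemma fourier_inverse_fourier:
  "h \<in> rapidly_decreasing l \<Longrightarrow> fourier v (inverse_fourier h) = h"
  using bij_betw_fourier by (simp add: bij_betw_def f_inv_into_f)

text \<open>The sum of the expansion and \<open>inverse_fourier h\<close> both have transform
  \<open>h\<close>, and the transform is injective on the whole Hilbert space.\<close>

lemma inverse_fourier_has_sum:
  assumes "h \<in> rapidly_decreasing l"
  shows "((\<lambda>\<xi>. h \<xi> *\<^sub>C u \<xi>) has_sum inverse_fourier h) UNIV"
  using expansion_has_sum[OF assms] fourier_expansion[OF expansion_has_sum[OF assms]]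
    fourier_inverse_fourier[OF assms] fourier_inject by metis

lemma fourier_inversion:
  assumes "f \<in> test_functions l v"
  shows "((\<lambda>\<xi>. fourier v f \<xi> *\<^sub>C u \<xi>) has_sum f) UNIV"
  using inverse_fourier_has_sum[of "fourier v f"] fourier_inverse_fourier[of "fourier v f"]
    fourier_inject assms unfolding mem_test_functions_iff by metis

lemma inverse_fourier_add:
  assumes "a \<in> rapidly_decreasing l" "b \<in> rapidly_decreasing l"
  shows "inverse_fourier (a + b) = inverse_fourier a + inverse_fourier b"
  by (rule fourier_inject)
     (simp add: fourier_add fourier_inverse_fourier assms rapidly_decreasing_add)

lemma inverse_fourier_scale:
  assumes "a \<in> rapidly_decreasing l"
  shows "inverse_fourier (\<lambda>\<xi>. c * a \<xi>) = c *\<^sub>C inverse_fourier a"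
  by (rule fourier_inject)
     (simp add: fourier_scaleC fourier_inverse_fourier assms rapidly_decreasing_scale)

text \<open>The seminorms on test functions are pullbacks under \<open>fourier v\<close>, so its
  additivity gives the isometry condition.\<close>

lemma homeomorphic_maps_fourier:
  "homeomorphic_maps (test_topology l v) (rapid_topology l) (fourier v) inverse_fourier"
  unfolding test_topology_eq rapid_topology_eq
  by (rule homeomorphic_maps_seminorm_isometry[OF bij_betw_fourier])
     (simp_all add: fourier_diff fourier_zero rapid_seminorm_zero)

lemma homeomorphic_map_fourier:
  "homeomorphic_map (test_topology l v) (rapid_topology l) (fourier v)"
  using homeomorphic_maps_fourier by (rule homeomorphic_maps_imp_map)

section \<open>The transform of distributions by duality\<close>

lemma dual_fourier_apply:
  "a \<in> rapidly_decreasing l \<Longrightarrow> dual_fourier l v x a = x (inverse_fourier a)"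
  by (simp add: dual_fourier_def)

lemma topspace_distribution_topology:
  "topspace (distribution_topology l v) = antidual (*\<^sub>C) (test_topology l v)"
  by (auto simp: distribution_topology_def weak_star_topology_def antidual_def
      extensional_def)

lemma dual_fourier_antidual:
  assumes x: "x \<in> antidual (*\<^sub>C) (test_topology l v)"
  shows "dual_fourier l v x \<in> antidual (\<lambda>c \<phi> \<xi>. c * \<phi> \<xi>) (rapid_topology l)"
proof -
  have "continuous_map (rapid_topology l) euclidean (x \<circ> inverse_fourier)"
    using x homeomorphic_maps_fourier
    by (intro continuous_map_compose) (auto simp: antidual_def homeomorphic_maps_def)
  \<comment> \<open>The extensional functional agrees with the composition on
    \<open>rapidly_decreasing l\<close>, which is the whole underlying space.\<close>
  then have "continuous_map (rapid_topology l) euclidean (dual_fourier l v x)"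
    by (rule continuous_map_eq) (simp add: topspace_rapid_topology dual_fourier_apply)
  then show ?thesis
    using x
    by (auto simp: antidual_def topspace_rapid_topology topspace_test_topology dual_fourier_apply
        rapidly_decreasing_add rapidly_decreasing_scale inverse_fourier_add inverse_fourier_scale
        inverse_fourier_in)
       (simp add: dual_fourier_def)
qed

text \<open>Weak-star continuity is checked one argument \<open>a\<close> at a time, and the image
  evaluated at \<open>a\<close> is \<open>x\<close> evaluated at \<open>inverse_fourier a\<close>, a
  coordinate projection.\<close>

lemma continuous_map_dual_fourier:
  "continuous_map (distribution_topology l v) (tempered_topology l) (dual_fourier l v)"
  unfolding tempered_topology_def weak_star_topology_def continuous_map_in_subtopology
    continuous_map_componentwise topspace_rapid_topology
proof (intro conjI ballI)
  show "dual_fourier l v ` topspace (distribution_topology l v) \<subseteq> extensional (rapidly_decreasing l)"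
    by (auto simp: dual_fourier_def)
  fix a assume a: "a \<in> rapidly_decreasing l"
  have "continuous_map (distribution_topology l v) euclidean (\<lambda>x. x (inverse_fourier a))"
    unfolding distribution_topology_def weak_star_topology_def
    by (intro continuous_map_from_subtopology continuous_map_product_projection)
       (simp add: topspace_test_topology inverse_fourier_in[OF a])
  then show "continuous_map (distribution_topology l v) euclidean (\<lambda>x. dual_fourier l v x a)"
    by (simp add: dual_fourier_apply[OF a])
qed (auto simp: topspace_distribution_topology dual_fourier_antidual)

lemma linear_dual_fourier:
  "linear_on_functionals (test_functions l v) (rapidly_decreasing l) D (dual_fourier l v)"
  by (auto simp: linear_on_functionals_def dual_fourier_def inverse_fourier_in intro!: restrict_ext)

section \<open>Embedding of the Hilbert space into the distributions\<close>

lemma test_functions_add: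
  "f \<in> test_functions l v \<Longrightarrow> g \<in> test_functions l v \<Longrightarrow> f + g \<in> test_functions l v"
  by (simp add: mem_test_functions_iff fourier_add rapidly_decreasing_add)

lemma test_functions_scaleC: "f \<in> test_functions l v \<Longrightarrow> c *\<^sub>C f \<in> test_functions l v"
  by (simp add: mem_test_functions_iff fourier_scaleC rapidly_decreasing_scale)

lemma test_functions_diff:
  "f \<in> test_functions l v \<Longrightarrow> g \<in> test_functions l v \<Longrightarrow> f - g \<in> test_functions l v"
  by (simp add: mem_test_functions_iff fourier_diff rapidly_decreasing_diff)

text \<open>By the inversion formula and the expansion bound, the norm of a test function is
  dominated by one seminorm of its transform. Cauchy-Schwarz then controls the increments of
  \<open>cinner f\<close>.\<close>

lemma continuous_map_cinner: "continuous_map (test_topology l v) euclidean (cinner f)"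
proof -
  obtain k :: nat and C where C: "0 \<le> C" and bound:
    "\<And>h. h \<in> rapidly_decreasing l \<Longrightarrow> norm (\<Sum>\<^sub>\<infinity>\<xi>. h \<xi> *\<^sub>C u \<xi>) \<le> C * rapid_seminorm l k h"
    by (rule norm_expansion_bound) (rule that; blast)
  have norm: "norm g \<le> C * rapid_seminorm l k (fourier v g)" if "g \<in> test_functions l v" for g
    using bound[of "fourier v g"] infsumI[OF fourier_inversion[OF that]] that
    by (simp add: mem_test_functions_iff)
  show ?thesis
    unfolding test_topology_eq
  proof (rule continuous_map_seminorm_bounded[where k = k and C = "norm f * C"])
    fix x y assume "x \<in> test_functions l v" "y \<in> test_functions l v"
    then have xy: "y - x \<in> test_functions l v" by (rule test_functions_diff[rotated])
    show "norm (cinner f y - cinner f x) \<le> norm f * C * rapid_seminorm l k (fourier v (y - x))"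
      using Cauchy_Schwarz_cinner[of f "y - x"] mult_left_mono[OF norm[OF xy], of "norm f"]
      by (simp add: cinner_diff_right)
    show "0 \<le> rapid_seminorm l k (fourier v (y - x))"
      using xy by (simp add: mem_test_functions_iff rapid_seminorm_nonneg)
  qed (simp add: fourier_zero rapid_seminorm_zero)
qed

lemma inner_functional_antidual:
  "inner_functional l v f \<in> topspace (distribution_topology l v)"
proof -
  have "continuous_map (test_topology l v) euclidean (inner_functional l v f)"
    by (rule continuous_map_eq[OF continuous_map_cinner[of f]])
       (simp add: inner_functional_def topspace_test_topology)
  then show ?thesis
    by (auto simp: topspace_distribution_topology antidual_def topspace_test_topology
        inner_functional_def cinner_add_right cinner_scaleC_right
        test_functions_add test_functions_scaleC)
qed

text \<open>This is the sense in which the transform on distributions extends the one on the Hilbert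
  space: the image of \<open>f\<close> pairs with \<open>a\<close> as the sequence
  \<open>fourier u f\<close> does. The coefficients are against \<open>u\<close> because the inverse
  transform of \<open>a\<close> is expanded in \<open>u\<close>.\<close>

lemma dual_fourier_inner_functional_has_sum:
  assumes "a \<in> rapidly_decreasing l"
  shows "((\<lambda>\<xi>. fourier u f \<xi> * cnj (a \<xi>)) has_sum
           dual_fourier l v (inner_functional l v f) a) UNIV"
proof -
  have "((\<lambda>\<xi>. cinner f (a \<xi> *\<^sub>C u \<xi>)) has_sum cinner f (inverse_fourier a)) UNIV"
    by (rule has_sum_bounded_linear[OF bounded_linear_cinner_right inverse_fourier_has_sum[OF assms]])
  then show ?thesis
    by (simp add: dual_fourier_apply assms inner_functional_def inverse_fourier_in fourier_def
        cinner_scaleC_right mult.commute)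
qed

lemmas fourier_facts =
  homeomorphic_map_fourier inverse_fourier_has_sum fourier_inversion
  continuous_map_dual_fourier linear_dual_fourier dual_fourier_apply
  inner_functional_antidual dual_fourier_inner_functional_has_sum

end

theorem proposition4p2:
  fixes u v :: "'i::countable \<Rightarrow> 'h::complex_hilbert_space"
    and l :: "'i \<Rightarrow> complex"
    and s\<^sub>0 :: real
  assumes separable: "separable_space (euclidean :: 'h topology)"
    and riesz: "riesz_basis u"
    and biorth: "biorthogonal u v"
    and s0_pos: "s\<^sub>0 > 0"
    and l_summable: "(\<lambda>\<xi>. (1 + cmod (l \<xi>)) powr (- s\<^sub>0)) summable_on UNIV"
  shows
    "homeomorphic_map (test_topology l v) (rapid_topology l) (fourier v) \<and>
     (\<forall>h \<in> rapidly_decreasing l.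
        ((\<lambda>\<xi>. h \<xi> *\<^sub>C u \<xi>) has_sum inv_into (test_functions l v) (fourier v) h) UNIV) \<and>
     (\<forall>f \<in> test_functions l v. ((\<lambda>\<xi>. fourier v f \<xi> *\<^sub>C u \<xi>) has_sum f) UNIV) \<and>

     homeomorphic_map (test_topology l u) (rapid_topology l) (fourier u) \<and>
     (\<forall>h \<in> rapidly_decreasing l.
        ((\<lambda>\<xi>. h \<xi> *\<^sub>C v \<xi>) has_sum inv_into (test_functions l u) (fourier u) h) UNIV) \<and>
     (\<forall>f \<in> test_functions l u. ((\<lambda>\<xi>. fourier u f \<xi> *\<^sub>C v \<xi>) has_sum f) UNIV) \<and>

     continuous_map (distribution_topology l u) (tempered_topology l) (dual_fourier l u) \<and>
     linear_on_functionals (test_functions l u) (rapidly_decreasing l)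
       (topspace (distribution_topology l u)) (dual_fourier l u) \<and>
     (\<forall>x \<in> topspace (distribution_topology l u). \<forall>a \<in> rapidly_decreasing l.
        dual_fourier l u x a = x (inv_into (test_functions l u) (fourier u) a)) \<and>
     (\<forall>f. inner_functional l u f \<in> topspace (distribution_topology l u) \<and>
        (\<forall>a \<in> rapidly_decreasing l.
           ((\<lambda>\<xi>. fourier v f \<xi> * cnj (a \<xi>)) has_sum dual_fourier l u (inner_functional l u f) a) UNIV)) \<and>

     continuous_map (distribution_topology l v) (tempered_topology l) (dual_fourier l v) \<and>
     linear_on_functionals (test_functions l v) (rapidly_decreasing l)
       (topspace (distribution_topology l v)) (dual_fourier l v) \<and>
     (\<forall>x \<in> topspace (distribution_topology l v). \<forall>a \<in> rapidly_decreasing l.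
        dual_fourier l v x a = x (inv_into (test_functions l v) (fourier v) a)) \<and>
     (\<forall>f. inner_functional l v f \<in> topspace (distribution_topology l v) \<and>
        (\<forall>a \<in> rapidly_decreasing l.
           ((\<lambda>\<xi>. fourier u f \<xi> * cnj (a \<xi>)) has_sum dual_fourier l v (inner_functional l v f) a) UNIV))"
proof -
  have "biorthogonal v u"
    unfolding biorthogonal_def
  proof (intro allI)
    fix \<xi> \<eta>
    show "cinner (v \<xi>) (u \<eta>) = (if \<xi> = \<eta> then 1 else 0)"
      using biorth cinner_commute[of "v \<xi>" "u \<eta>"] by (simp add: biorthogonal_def)
  qed
  note bt = riesz_basis_bounded_total[OF riesz biorth]
  \<comment> \<open>\<open>uv\<close> supplies the claims about \<open>test_functions l v\<close>
    and its dual, \<open>vu\<close> those about \<open>test_functions l u\<close> and its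
    dual.\<close>
  interpret uv: biorthogonal_system u v l s\<^sub>0
    by (intro biorthogonal_system.intro biorth bt(1,4) l_summable)
  interpret vu: biorthogonal_system v u l s\<^sub>0
    by (intro biorthogonal_system.intro \<open>biorthogonal v u\<close> bt(2,3) l_summable)
  show ?thesis
    by (intro conjI ballI allI uv.fourier_facts vu.fourier_facts)
qed

end
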